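(* Let $H^D$ be the discrete Maxwell operator, i.e. the bounded self-adjoint operator on $\mathcal H^D=L^2(\mathbb T^3;\mathbb C^6)$ of multiplication by the matrix function $x\mapsto H^D(x)$ defined in the context. Then the point spectrum $\sigma_p(H^D)$ of $H^D$ is reduced to $\{0\}$.
   Context: $\mathbb T^3=(\mathbb R/2\pi\mathbb Z)^3$. Let $\varepsilon_1,\varepsilon_2,\varepsilon_3,\mu_1,\mu_2,\mu_3\in(0,\infty)$, $\boldsymbol\varepsilon=\mathrm{diag}(\varepsilon_j)$, $\boldsymbol\mu=\mathrm{diag}(\mu_j)$ and $\hat D=\mathrm{diag}(\boldsymbol\varepsilon,\boldsymbol\mu)$ ($6\times6$). For $y\in\mathbb R^3$ put $M(y)=\begin{pmatrix}0&-y_3&y_2\\ y_3&0&-y_1\\ -y_2&y_1&0\end{pmatrix}$ and $h^D(y)=\begin{pmatrix}0&\boldsymbol\varepsilon M(y)\\ -\boldsymbol\mu M(y)&0\end{pmatrix}$. For $x\in\mathbb T^3$, $H^D(x)=h^D(\sin x)$ with $\sin x=(\sin x_1,\sin x_2,\sin x_3)$. $\mathcal H^D=L^2(\mathbb T^3;\mathbb C^6)$ carries the inner product $(u,v)_{\mathcal H^D}=\int_{\mathbb T^3}\langle\hat D^{-1}u(x),v(x)\rangle_{\mathbb C^6}\,dx$. The point spectrum is the set of eigenvalues. *)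

theory Defs
  imports "HOL-Analysis.Analysis" "HOL-Library.Real_Mod"
begin

quotient_type circle = real / "\<lambda>s t. [s = t] (rmod (2 * pi))"
  by (intro equivpI reflpI sympI transpI) (auto simp: rcong_def)

type_synonym torus = "circle ^ 3"

lift_definition circle_sin :: "circle \<Rightarrow> real" is sin
proof -
  fix s t :: real
  assume "[s = t] (rmod (2 * pi))"
  then obtain n :: int where "t = s + of_int n * (2 * pi)"
    by (auto simp: rcong_altdef)
  then show "sin s = sin t"
    using sin.plus_of_int[of s n] by (simp add: mult.commute)
qed

definition torus_proj :: "real ^ 3 \<Rightarrow> torus" where
  "torus_proj y = (\<chi> j. abs_circle (y $ j))"

text \<open>
  Sets are measurable when their preimage in \<open>\<real>\<^sup>3\<close> is Borel; the measure is the image of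
  Lebesgue measure on the fundamental domain \<open>[0, 2 \<pi>)\<^sup>3\<close>, so its total mass is \<open>(2 \<pi>)\<^sup>3\<close>.
\<close>

definition torus_measure :: "torus measure" where
  "torus_measure =
     distr (restrict_space lborel {y. \<forall>j. 0 \<le> y $ j \<and> y $ j < 2 * pi})
       (sigma UNIV {A. torus_proj -` A \<in> sets borel}) torus_proj"

lemma circle_sin_torus_proj [simp]: "circle_sin (torus_proj y $ j) = sin (y $ j)"
  by (simp add: torus_proj_def circle_sin.abs_eq)

lemma surj_torus_proj: "surj torus_proj"
proof (rule surjI)
  show "torus_proj (\<chi> j. rep_circle (x $ j)) = x" for x
    by (simp add: torus_proj_def vec_eq_iff Quotient3_abs_rep[OF Quotient3_circle])
qed

lemma space_torus_measure [simp]: "space torus_measure = UNIV"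
  by (simp add: torus_measure_def)

lemma sets_torus_measure: "sets torus_measure = {A. torus_proj -` A \<in> sets borel}"
proof -
  have "sigma_algebra UNIV {A. torus_proj -` A \<in> sets borel}"
    unfolding sigma_algebra_iff2
    by (auto simp: vimage_Diff vimage_UN intro!: sets.countable_UN borel_comp
             simp flip: Compl_eq_Diff_UNIV simp: vimage_Compl)
  then show ?thesis
    by (simp add: torus_measure_def sigma_algebra.sigma_sets_eq)
qed

lemma measurable_torus_measure_iff:
  "f \<in> measurable torus_measure N \<longleftrightarrow> f \<circ> torus_proj \<in> measurable borel N"
  using surj_torus_proj
  by (auto simp: measurable_def sets_torus_measure vimage_comp surj_def Pi_iff) metis

lemma circle_sin_measurable [measurable]:
  "(\<lambda>x. circle_sin (x $ j)) \<in> borel_measurable torus_measure"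
  by (simp add: measurable_torus_measure_iff comp_def)

lemma emeasure_torus_measure:
  assumes "A \<in> sets torus_measure"
  shows "emeasure torus_measure A =
    emeasure lborel (torus_proj -` A \<inter> {y. \<forall>j. 0 \<le> y $ j \<and> y $ j < 2 * pi})"
proof -
  let ?Q = "{y :: real ^ 3. \<forall>j. 0 \<le> y $ j \<and> y $ j < 2 * pi}"
  have Q: "?Q \<in> sets borel"
    by measurable
  have *: "torus_proj \<in> measurable (restrict_space lborel ?Q)
      (sigma UNIV {A. torus_proj -` A \<in> sets borel})"
    using Q by (intro measurable_measure_of)
      (auto simp: space_restrict_space sets_restrict_space Int_commute)
  have A: "A \<in> sets (sigma UNIV {A. torus_proj -` A \<in> sets borel})"
    using assms by (simp add: torus_measure_def)
  show ?thesis
    unfolding torus_measure_def emeasure_distr[OF * A]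
    using Q by (simp add: emeasure_restrict_space space_restrict_space)
qed

text \<open>
  \<open>\<complex>\<^sup>6 = \<complex>\<^sup>3 \<oplus> \<complex>\<^sup>3\<close> is indexed by the sum type \<open>3 + 3\<close>, which makes the block
  structure of the matrices explicit.
\<close>

type_synonym c6 = "complex ^ (3 + 3)"

definition square_integrable :: "(torus \<Rightarrow> c6) \<Rightarrow> bool" where
  "square_integrable u \<longleftrightarrow>
     u \<in> borel_measurable torus_measure \<and> integrable torus_measure (\<lambda>x. (norm (u x))\<^sup>2)"

definition L2_rel :: "(torus \<Rightarrow> c6) \<Rightarrow> (torus \<Rightarrow> c6) \<Rightarrow> bool" where
  "L2_rel u v \<longleftrightarrow>
     square_integrable u \<and> square_integrable v \<and> (AE x in torus_measure. u x = v x)"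

lemma square_integrable_zero: "square_integrable (\<lambda>x. 0)"
  by (simp add: square_integrable_def)

text \<open>
  Genuine \<open>L\<^sup>2\<close> elements: classes of square integrable functions modulo equality almost
  everywhere. The weighted inner product depends on the parameters, so it is given below as a
  function rather than through a type class instance.
\<close>

quotient_type L2 = "torus \<Rightarrow> c6" / partial: L2_rel
proof (rule part_equivpI)
  show "\<exists>u. L2_rel u u"
    using square_integrable_zero by (auto simp: L2_rel_def)
  show "symp L2_rel"
    by (auto intro!: sympI simp: L2_rel_def)
  show "transp L2_rel"
    by (rule transpI) (auto simp: L2_rel_def elim: AE_mp)
qed

lemma square_integrable_bound:
  assumes "square_integrable u" "v \<in> borel_measurable torus_measure"
    and "\<And>x. norm (v x) \<le> C * norm (u x)"
  shows "square_integrable v"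
proof -
  have "integrable torus_measure (\<lambda>x. C\<^sup>2 * (norm (u x))\<^sup>2)"
    using assms(1) by (simp add: square_integrable_def)
  then have "integrable torus_measure (\<lambda>x. (norm (v x))\<^sup>2)"
  proof (rule Bochner_Integration.integrable_bound[OF _ _ AE_I2])
    show "(\<lambda>x. (norm (v x))\<^sup>2) \<in> borel_measurable torus_measure"
      using assms(2) by simp
    show "norm ((norm (v x))\<^sup>2) \<le> norm (C\<^sup>2 * (norm (u x))\<^sup>2)" for x
      using power_mono[OF assms(3)[of x], of 2] by (simp add: power_mult_distrib)
  qed
  with assms(2) show ?thesis
    by (simp add: square_integrable_def)
qed

lemma square_integrable_add:
  assumes "square_integrable u" "square_integrable v"
  shows "square_integrable (\<lambda>x. u x + v x)"
proof -
  have [measurable]: "u \<in> borel_measurable torus_measure" "v \<in> borel_measurable torus_measure"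
    using assms by (auto simp: square_integrable_def)
  have "integrable torus_measure (\<lambda>x. 2 * (norm (u x))\<^sup>2 + 2 * (norm (v x))\<^sup>2)"
    using assms by (simp add: square_integrable_def)
  moreover have "norm ((norm (u x + v x))\<^sup>2) \<le> norm (2 * (norm (u x))\<^sup>2 + 2 * (norm (v x))\<^sup>2)" for x
  proof -
    have "(norm (u x + v x))\<^sup>2 \<le> (norm (u x) + norm (v x))\<^sup>2"
      by (simp add: norm_triangle_ineq power_mono)
    also have "\<dots> \<le> 2 * (norm (u x))\<^sup>2 + 2 * (norm (v x))\<^sup>2"
      using zero_le_power2[of "norm (u x) - norm (v x)"] by (simp add: power2_eq_square algebra_simps)
    finally show ?thesis by simp
  qed
  ultimately show ?thesis
    unfolding square_integrable_def by (auto intro: Bochner_Integration.integrable_bound)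
qed

lemma norm_smult_c6: "norm (c *s a) = cmod c * norm a" for a :: c6
  by (simp add: norm_vec_def norm_mult L2_set_right_distrib)

lemma borel_measurable_vec:
  fixes f :: "'a \<Rightarrow> complex ^ 'n"
  assumes "\<And>i. (\<lambda>x. f x $ i) \<in> borel_measurable M"
  shows "f \<in> borel_measurable M"
proof (subst borel_measurable_euclidean_space, intro ballI)
  fix b :: "complex ^ 'n" assume "b \<in> Basis"
  have "(\<lambda>x. f x \<bullet> b) = (\<lambda>x. \<Sum>i\<in>UNIV. f x $ i \<bullet> b $ i)"
    by (simp add: inner_vec_def)
  then show "(\<lambda>x. f x \<bullet> b) \<in> borel_measurable M"
    using assms by simp
qed

lemma borel_measurable_vec_nth [measurable (raw)]:
  fixes f :: "'a \<Rightarrow> complex ^ 'n"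
  assumes "f \<in> borel_measurable M"
  shows "(\<lambda>x. f x $ i) \<in> borel_measurable M"
  using measurable_compose[OF assms borel_measurable_continuous_onI[of "\<lambda>v. v $ i"]]
  by (simp add: continuous_intros)

lemma square_integrable_smult:
  assumes "square_integrable u"
  shows "square_integrable (\<lambda>x. c *s u x)"
proof (rule square_integrable_bound[OF assms])
  have [measurable]: "u \<in> borel_measurable torus_measure"
    using assms by (simp add: square_integrable_def)
  show "(\<lambda>x. c *s u x) \<in> borel_measurable torus_measure"
    by (rule borel_measurable_vec) simp
  show "norm (c *s u x) \<le> cmod c * norm (u x)" for x
    by (simp add: norm_smult_c6)
qed

instantiation L2 :: ab_group_add
begin

lift_definition zero_L2 :: L2 is "\<lambda>x. 0"
  by (simp add: L2_rel_def square_integrable_zero)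

lift_definition plus_L2 :: "L2 \<Rightarrow> L2 \<Rightarrow> L2" is "\<lambda>u v x. u x + v x"
  by (auto simp: L2_rel_def square_integrable_add elim: AE_mp)

lift_definition uminus_L2 :: "L2 \<Rightarrow> L2" is "\<lambda>u x. - u x"
  by (auto simp: L2_rel_def square_integrable_def)

definition minus_L2 :: "L2 \<Rightarrow> L2 \<Rightarrow> L2" where "minus_L2 f g = f + - g"

instance
proof
  fix a b c :: L2
  show "a + b + c = a + (b + c)"
    by transfer (auto simp: L2_rel_def square_integrable_add add.assoc)
  show "a + b = b + a"
    by transfer (auto simp: L2_rel_def square_integrable_add add.commute)
  show "0 + a = a"
    by transfer (auto simp: L2_rel_def)
  show "- a + a = 0"
    by transfer (auto simp: L2_rel_def square_integrable_zero)
  show "a - b = a + - b"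
    by (simp add: minus_L2_def)
qed

end

lift_definition scale_L2 :: "complex \<Rightarrow> L2 \<Rightarrow> L2" (infixr \<open>*\<^sub>L\<close> 75) is "\<lambda>c u x. c *s u x"
  by (auto simp: L2_rel_def square_integrable_smult elim: AE_mp)

interpretation L2: vector_space scale_L2
proof
  fix a b :: complex and f g :: L2
  show "a *\<^sub>L (f + g) = a *\<^sub>L f + a *\<^sub>L g"
    by transfer (auto simp: L2_rel_def square_integrable_add square_integrable_smult
        vector_space_over_itself.scale_right_distrib vec.scale_right_distrib)
  show "(a + b) *\<^sub>L f = a *\<^sub>L f + b *\<^sub>L f"
    by transfer (auto simp: L2_rel_def square_integrable_add square_integrable_smult
        vec.scale_left_distrib)
  show "a *\<^sub>L b *\<^sub>L f = (a * b) *\<^sub>L f"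
    by transfer (auto simp: L2_rel_def square_integrable_smult)
  show "1 *\<^sub>L f = f"
    by transfer (auto simp: L2_rel_def square_integrable_smult)
qed

definition point_spectrum :: "(L2 \<Rightarrow> L2) \<Rightarrow> complex set" where
  "point_spectrum T = {c. \<exists>f. f \<noteq> 0 \<and> T f = c *\<^sub>L f}"

definition diag :: "'a::zero ^ 'n \<Rightarrow> 'a ^ 'n ^ 'n" where
  "diag d = (\<chi> i j. if i = j then d $ i else 0)"

definition block_matrix ::
  "'a ^ 'n ^ 'n \<Rightarrow> 'a ^ 'm ^ 'n \<Rightarrow> 'a ^ 'n ^ 'm \<Rightarrow> 'a ^ 'm ^ 'm \<Rightarrow> 'a ^ ('n + 'm) ^ ('n + 'm)" where
  "block_matrix A B C D = (\<chi> i j.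
     case i of
       Inl k \<Rightarrow> (case j of Inl l \<Rightarrow> A $ k $ l | Inr l \<Rightarrow> B $ k $ l)
     | Inr k \<Rightarrow> (case j of Inl l \<Rightarrow> C $ k $ l | Inr l \<Rightarrow> D $ k $ l))"

definition Dhat :: "real ^ 3 \<Rightarrow> real ^ 3 \<Rightarrow> real ^ (3 + 3) ^ (3 + 3)" where
  "Dhat \<epsilon> \<mu> = block_matrix (diag \<epsilon>) 0 0 (diag \<mu>)"

definition Mcross :: "real ^ 3 \<Rightarrow> real ^ 3 ^ 3" where
  "Mcross y = vector [vector [0, - y $ 3, y $ 2],
                      vector [y $ 3, 0, - y $ 1],
                      vector [- y $ 2, y $ 1, 0]]"

definition maxwell_symbol :: "real ^ 3 \<Rightarrow> real ^ 3 \<Rightarrow> real ^ 3 \<Rightarrow> real ^ (3 + 3) ^ (3 + 3)" where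
  "maxwell_symbol \<epsilon> \<mu> y =
     block_matrix 0 (diag \<epsilon> ** Mcross y) (- (diag \<mu> ** Mcross y)) 0"

definition maxwell_matrix :: "real ^ 3 \<Rightarrow> real ^ 3 \<Rightarrow> torus \<Rightarrow> real ^ (3 + 3) ^ (3 + 3)" where
  "maxwell_matrix \<epsilon> \<mu> x = maxwell_symbol \<epsilon> \<mu> (\<chi> j. circle_sin (x $ j))"

definition complex_matrix :: "real ^ 'n ^ 'm \<Rightarrow> complex ^ 'n ^ 'm" where
  "complex_matrix A = (\<chi> i j. complex_of_real (A $ i $ j))"

definition cdot :: "complex ^ 'n \<Rightarrow> complex ^ 'n \<Rightarrow> complex" where
  "cdot a b = (\<Sum>i\<in>UNIV. a $ i * cnj (b $ i))"

lemma complex_matrix_mult_measurable: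
  assumes "\<And>i j. (\<lambda>x. A x $ i $ j) \<in> borel_measurable M" "u \<in> borel_measurable M"
  shows "(\<lambda>x. complex_matrix (A x) *v u x) \<in> borel_measurable M"
proof (rule borel_measurable_vec)
  note [measurable] = assms
  show "(\<lambda>x. (complex_matrix (A x) *v u x) $ i) \<in> borel_measurable M" for i
    unfolding matrix_vector_mult_def complex_matrix_def by simp
qed

text \<open>
  The pairing is linear in the first argument and conjugate-linear in the second, as is
  \<^const>\<open>cdot\<close>.
\<close>

lift_definition maxwell_inner :: "real ^ 3 \<Rightarrow> real ^ 3 \<Rightarrow> L2 \<Rightarrow> L2 \<Rightarrow> complex"
  is "\<lambda>\<epsilon> \<mu> u v. LINT x|torus_measure.
        cdot (complex_matrix (matrix_inv (Dhat \<epsilon> \<mu>)) *v u x) (v x)"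
proof -
  fix \<epsilon> \<mu> u u' v v'
  assume *: "L2_rel u u'" "L2_rel v v'"
  have [measurable]: "(\<lambda>x. cdot (complex_matrix (matrix_inv (Dhat \<epsilon> \<mu>)) *v f x) (g x))
      \<in> borel_measurable torus_measure"
    if "square_integrable f" "square_integrable g" for f g
  proof -
    have [measurable]: "f \<in> borel_measurable torus_measure" "g \<in> borel_measurable torus_measure"
      using that by (auto simp: square_integrable_def)
    have [measurable]: "(\<lambda>x. complex_matrix (matrix_inv (Dhat \<epsilon> \<mu>)) *v f x)
        \<in> borel_measurable torus_measure"
      by (rule complex_matrix_mult_measurable) auto
    show ?thesis
      unfolding cdot_def
      by (intro borel_measurable_sum borel_measurable_times
          measurable_compose[OF _ borel_measurable_continuous_onI[of cnj]]) (auto intro: continuous_intros)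
  qed
  show "(LINT x|torus_measure. cdot (complex_matrix (matrix_inv (Dhat \<epsilon> \<mu>)) *v u x) (v x)) =
      (LINT x|torus_measure. cdot (complex_matrix (matrix_inv (Dhat \<epsilon> \<mu>)) *v u' x) (v' x))"
    using * by (intro integral_cong_AE) (auto simp: L2_rel_def)
qed

lemma maxwell_matrix_measurable [measurable]:
  "(\<lambda>x. maxwell_matrix \<epsilon> \<mu> x $ i $ j) \<in> borel_measurable torus_measure"
proof -
  have M: "(\<lambda>x. Mcross (\<chi> j. circle_sin (x $ j)) $ k $ l) \<in> borel_measurable torus_measure" for k l
    using exhaust_3[of k] exhaust_3[of l] by (auto simp: Mcross_def)
  show ?thesis
    unfolding maxwell_matrix_def maxwell_symbol_def block_matrix_def
    by (cases i; cases j) (auto simp: matrix_matrix_mult_def intro!: borel_measurable_sum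
        borel_measurable_times M)
qed

lemma diag_mult_nth: "(diag d ** A) $ i $ j = d $ i * A $ i $ j"
  for d :: "'a::semiring_1 ^ 'n"
  by (simp add: matrix_matrix_mult_def diag_def mult_delta_left)

lemma maxwell_matrix_nth_le: "\<bar>maxwell_matrix \<epsilon> \<mu> x $ i $ j\<bar> \<le> norm \<epsilon> + norm \<mu>"
proof -
  define N where "N = Mcross (\<chi> j. circle_sin (x $ j))"
  have s: "\<bar>circle_sin c\<bar> \<le> 1" for c
    by transfer simp
  have N: "\<bar>N $ k $ l\<bar> \<le> 1" for k l
    using exhaust_3[of k] exhaust_3[of l] s by (auto simp: N_def Mcross_def)
  have "\<bar>v $ k * N $ k $ l\<bar> \<le> norm v" for v :: "real ^ 3" and k l
    using mult_mono[OF component_le_norm_cart[of v k] N[of k l]] by (simp add: abs_mult)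
  from add_mono[OF this[of \<epsilon>] norm_ge_zero[of \<mu>]] add_mono[OF norm_ge_zero[of \<epsilon>] this[of \<mu>]]
  show ?thesis
    unfolding maxwell_matrix_def maxwell_symbol_def N_def[symmetric]
    by (cases i; cases j) (auto simp: block_matrix_def diag_mult_nth)
qed

lemma maxwell_matrix_bounded:
  obtains C where "\<And>x a. norm (complex_matrix (maxwell_matrix \<epsilon> \<mu> x) *v a) \<le> C * norm a"
proof
  fix x a
  let ?B = "norm \<epsilon> + norm \<mu>" and ?A = "complex_matrix (maxwell_matrix \<epsilon> \<mu> x)"
  have "norm (?A *v a) \<le> (\<Sum>i\<in>UNIV. norm ((?A *v a) $ i))"
    unfolding norm_vec_def by (rule L2_set_le_sum) simp
  also have "\<dots> \<le> (\<Sum>(i::3 + 3)\<in>UNIV. \<Sum>(j::3 + 3)\<in>UNIV. ?B * norm a)"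
  proof (rule sum_mono)
    fix i :: "3 + 3"
    have "norm ((?A *v a) $ i) \<le> (\<Sum>j\<in>UNIV. norm (?A $ i $ j * a $ j))"
      unfolding matrix_vector_mult_def by (simp add: norm_sum)
    also have "\<dots> \<le> (\<Sum>(j::3 + 3)\<in>UNIV. ?B * norm a)"
      unfolding norm_mult
      by (intro sum_mono mult_mono Finite_Cartesian_Product.norm_nth_le)
        (auto simp: complex_matrix_def maxwell_matrix_nth_le)
    finally show "norm ((?A *v a) $ i) \<le> (\<Sum>(j::3 + 3)\<in>UNIV. ?B * norm a)" .
  qed
  finally show "norm (?A *v a) \<le> (36 * ?B) * norm a"
    by (simp add: algebra_simps)
qed

lemma square_integrable_maxwell:
  assumes "square_integrable f"
  shows "square_integrable (\<lambda>x. complex_matrix (maxwell_matrix \<epsilon> \<mu> x) *v f x)"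
proof -
  obtain C where C: "\<And>x a. norm (complex_matrix (maxwell_matrix \<epsilon> \<mu> x) *v a) \<le> C * norm a"
    using maxwell_matrix_bounded[of \<epsilon> \<mu>] by blast
  have "f \<in> borel_measurable torus_measure"
    using assms by (simp add: square_integrable_def)
  then show ?thesis
    by (intro square_integrable_bound[OF assms _ C] complex_matrix_mult_measurable) auto
qed

lift_definition maxwell_op :: "real ^ 3 \<Rightarrow> real ^ 3 \<Rightarrow> L2 \<Rightarrow> L2"
  is "\<lambda>\<epsilon> \<mu> u x. complex_matrix (maxwell_matrix \<epsilon> \<mu> x) *v u x"
  by (auto simp: L2_rel_def square_integrable_maxwell elim: AE_mp)

lemma maxwell_op_linear:
  "Vector_Spaces.linear scale_L2 scale_L2 (maxwell_op \<epsilon> \<mu>)"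
proof (unfold_locales)
  show "maxwell_op \<epsilon> \<mu> (f + g) = maxwell_op \<epsilon> \<mu> f + maxwell_op \<epsilon> \<mu> g" for f g
    by transfer (auto simp: L2_rel_def square_integrable_add square_integrable_maxwell
        matrix_vector_right_distrib)
  show "maxwell_op \<epsilon> \<mu> (c *\<^sub>L f) = c *\<^sub>L maxwell_op \<epsilon> \<mu> f" for c f
    by transfer (auto simp: L2_rel_def square_integrable_smult square_integrable_maxwell
        vector_scalar_commute)
qed

definition dvec :: "real ^ 3 \<Rightarrow> real ^ 3 \<Rightarrow> real ^ (3 + 3)" where
  "dvec \<epsilon> \<mu> = (\<chi> i. case i of Inl k \<Rightarrow> \<epsilon> $ k | Inr k \<Rightarrow> \<mu> $ k)"

lemma matrix_inv_eqI:
  fixes A :: "'a::semiring_1 ^ 'n ^ 'm"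
  assumes "A ** B = mat 1" "B ** A = mat 1"
  shows "matrix_inv A = B"
  unfolding matrix_inv_def
proof (rule some_equality)
  show "A ** B = mat 1 \<and> B ** A = mat 1"
    using assms by simp
  show "C = B" if "A ** C = mat 1 \<and> C ** A = mat 1" for C
    using that assms by (metis matrix_mul_assoc matrix_mul_lid matrix_mul_rid)
qed

lemma Dhat_eq_diag: "Dhat \<epsilon> \<mu> = diag (dvec \<epsilon> \<mu>)"
  by (auto simp: Dhat_def dvec_def diag_def block_matrix_def vec_eq_iff split: sum.split)

lemma complex_matrix_inv_Dhat_mult:
  assumes "\<And>j. \<epsilon> $ j > 0" "\<And>j. \<mu> $ j > 0"
  shows "(complex_matrix (matrix_inv (Dhat \<epsilon> \<mu>)) *v a) $ i = a $ i / complex_of_real (dvec \<epsilon> \<mu> $ i)"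
proof -
  let ?d = "dvec \<epsilon> \<mu>"
  have d: "?d $ i \<noteq> 0" for i
    using assms(1) assms(2) by (cases i) (simp_all add: dvec_def less_imp_neq[symmetric])
  have e: "diag v ** diag w = mat 1" if "\<And>i. v $ i * w $ i = 1" for v w :: "real ^ (3 + 3)"
    using that by (auto simp: vec_eq_iff diag_mult_nth mat_def) (auto simp: diag_def)
  have "matrix_inv (Dhat \<epsilon> \<mu>) = diag (\<chi> i. 1 / ?d $ i)"
    unfolding Dhat_eq_diag by (rule matrix_inv_eqI; rule e) (simp_all add: d)
  then show ?thesis
    by (simp add: complex_matrix_def diag_def matrix_vector_mult_def
        if_distrib[of complex_of_real] mult_delta_left cong: if_cong)
qed

lemma maxwell_matrix_symmetric:
  assumes "\<And>j. \<epsilon> $ j > 0" "\<And>j. \<mu> $ j > 0"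
  shows "maxwell_matrix \<epsilon> \<mu> x $ i $ j / dvec \<epsilon> \<mu> $ i = maxwell_matrix \<epsilon> \<mu> x $ j $ i / dvec \<epsilon> \<mu> $ j"
proof -
  define N where "N = Mcross (\<chi> j. circle_sin (x $ j))"
  have N: "N $ k $ l + N $ l $ k = 0" for k l
    using exhaust_3[of k] exhaust_3[of l] by (auto simp: N_def Mcross_def)
  have "\<epsilon> $ k \<noteq> 0" "\<mu> $ k \<noteq> 0" for k
    using assms(1)[of k] assms(2)[of k] by auto
  then show ?thesis
    unfolding maxwell_matrix_def maxwell_symbol_def N_def[symmetric] dvec_def
    by (cases i; cases j) (auto simp: block_matrix_def diag_mult_nth eq_neg_iff_add_eq_0 neg_eq_iff_add_eq_0 N)
qed

lemma maxwell_op_self_adjoint: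
  assumes "\<And>j. \<epsilon> $ j > 0" "\<And>j. \<mu> $ j > 0"
  shows "maxwell_inner \<epsilon> \<mu> (maxwell_op \<epsilon> \<mu> f) g = maxwell_inner \<epsilon> \<mu> f (maxwell_op \<epsilon> \<mu> g)"
proof -
  have "cdot (complex_matrix (matrix_inv (Dhat \<epsilon> \<mu>)) *v
          (complex_matrix (maxwell_matrix \<epsilon> \<mu> x) *v a)) b =
        cdot (complex_matrix (matrix_inv (Dhat \<epsilon> \<mu>)) *v a)
          (complex_matrix (maxwell_matrix \<epsilon> \<mu> x) *v b)" (is "?l = ?r") for x and a b :: c6
  proof -
    let ?H = "maxwell_matrix \<epsilon> \<mu> x" and ?d = "dvec \<epsilon> \<mu>"
    have "?l = (\<Sum>i\<in>UNIV. \<Sum>j\<in>UNIV. of_real (?H $ i $ j / ?d $ i) * a $ j * cnj (b $ i))"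
      by (simp add: cdot_def complex_matrix_inv_Dhat_mult[OF assms])
        (simp add: matrix_vector_mult_def complex_matrix_def sum_distrib_right sum_divide_distrib)
    also have "\<dots> = (\<Sum>i\<in>UNIV. \<Sum>j\<in>UNIV. of_real (?H $ j $ i / ?d $ j) * a $ j * cnj (b $ i))"
      by (intro sum.cong refl arg_cong2[of _ _ _ _ "(*)"] arg_cong[of _ _ of_real]
          maxwell_matrix_symmetric[OF assms])
    also have "\<dots> = (\<Sum>j\<in>UNIV. \<Sum>i\<in>UNIV. of_real (?H $ j $ i / ?d $ j) * a $ j * cnj (b $ i))"
      by (rule sum.swap)
    also have "\<dots> = ?r"
      by (simp add: cdot_def complex_matrix_inv_Dhat_mult[OF assms])
        (simp add: matrix_vector_mult_def complex_matrix_def sum_distrib_left sum_divide_distrib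
          cnj_sum mult_ac)
    finally show ?thesis .
  qed
  then show ?thesis
    by transfer simp
qed

lemma cdot_Dhat:
  assumes "\<And>j. \<epsilon> $ j > 0" "\<And>j. \<mu> $ j > 0"
  shows "cdot (complex_matrix (matrix_inv (Dhat \<epsilon> \<mu>)) *v a) a =
    of_real (\<Sum>i\<in>UNIV. (cmod (a $ i))\<^sup>2 / dvec \<epsilon> \<mu> $ i)"
  by (simp add: cdot_def complex_matrix_inv_Dhat_mult[OF assms] complex_norm_square del: of_real_power)

lemma dvec_pos:
  assumes "\<And>j. \<epsilon> $ j > 0" "\<And>j. \<mu> $ j > 0"
  shows "dvec \<epsilon> \<mu> $ i > 0"
  using assms by (cases i) (auto simp: dvec_def)

lemma norm_sq_c6: "(norm a)\<^sup>2 = (\<Sum>i\<in>UNIV. (cmod (a $ i))\<^sup>2)" for a :: c6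
  by (simp add: norm_vec_def L2_set_def sum_nonneg)

lemma weighted_le_norm:
  assumes "\<And>j. \<epsilon> $ j > 0" "\<And>j. \<mu> $ j > 0"
  shows "(\<Sum>i\<in>UNIV. (cmod (a $ i))\<^sup>2 / dvec \<epsilon> \<mu> $ i)
    \<le> (\<Sum>i\<in>UNIV. 1 / dvec \<epsilon> \<mu> $ i) * (norm a)\<^sup>2"
proof -
  note d = dvec_pos[OF assms]
  have "1 / dvec \<epsilon> \<mu> $ i \<le> (\<Sum>i\<in>UNIV. 1 / dvec \<epsilon> \<mu> $ i)" for i
    by (rule member_le_sum) (auto simp: d less_imp_le)
  from mult_right_mono[OF this zero_le_power2] show ?thesis
    unfolding norm_sq_c6 sum_distrib_left by (intro sum_mono) simp
qed

lemma norm_le_weighted: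
  assumes "\<And>j. \<epsilon> $ j > 0" "\<And>j. \<mu> $ j > 0"
  shows "(norm a)\<^sup>2 \<le> (\<Sum>i\<in>UNIV. dvec \<epsilon> \<mu> $ i) *
    (\<Sum>i\<in>UNIV. (cmod (a $ i))\<^sup>2 / dvec \<epsilon> \<mu> $ i)"
proof -
  note d = dvec_pos[OF assms]
  have le: "dvec \<epsilon> \<mu> $ i \<le> (\<Sum>i\<in>UNIV. dvec \<epsilon> \<mu> $ i)" for i
    by (rule member_le_sum) (auto simp: d less_imp_le)
  have "(cmod (a $ i))\<^sup>2 \<le> (\<Sum>i\<in>UNIV. dvec \<epsilon> \<mu> $ i) * ((cmod (a $ i))\<^sup>2 / dvec \<epsilon> \<mu> $ i)" for i
    using mult_right_mono[OF le[of i], of "(cmod (a $ i))\<^sup>2 / dvec \<epsilon> \<mu> $ i"] d[of i] by simp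
  then show ?thesis
    unfolding norm_sq_c6 sum_distrib_left by (intro sum_mono)
qed

lemma weighted_integrable:
  assumes "\<And>j. \<epsilon> $ j > 0" "\<And>j. \<mu> $ j > 0" "square_integrable u"
  shows "integrable torus_measure (\<lambda>x. \<Sum>i\<in>UNIV. (cmod (u x $ i))\<^sup>2 / dvec \<epsilon> \<mu> $ i)"
proof (rule Bochner_Integration.integrable_bound[OF _ _ AE_I2])
  show "integrable torus_measure (\<lambda>x. (\<Sum>i\<in>UNIV. 1 / dvec \<epsilon> \<mu> $ i) * (norm (u x))\<^sup>2)"
    using assms(3) by (simp add: square_integrable_def)
  have [measurable]: "u \<in> borel_measurable torus_measure"
    using assms(3) by (simp add: square_integrable_def)
  show "(\<lambda>x. \<Sum>i\<in>UNIV. (cmod (u x $ i))\<^sup>2 / dvec \<epsilon> \<mu> $ i) \<in> borel_measurable torus_measure"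
    by measurable
  have nn: "(\<Sum>i\<in>UNIV. (cmod (u x $ i))\<^sup>2 / dvec \<epsilon> \<mu> $ i) \<ge> 0" for x
    by (intro sum_nonneg) (simp add: dvec_pos[OF assms(1,2)] less_imp_le)
  show "norm (\<Sum>i\<in>UNIV. (cmod (u x $ i))\<^sup>2 / dvec \<epsilon> \<mu> $ i)
      \<le> norm ((\<Sum>i\<in>UNIV. 1 / dvec \<epsilon> \<mu> $ i) * (norm (u x))\<^sup>2)" for x
    using order_trans[OF weighted_le_norm[OF assms(1,2), of "u x"] abs_ge_self]
    by (simp only: real_norm_def abs_of_nonneg[OF nn])
qed

lemma maxwell_inner_pos:
  assumes "\<And>j. \<epsilon> $ j > 0" "\<And>j. \<mu> $ j > 0" "f \<noteq> 0"
  shows "maxwell_inner \<epsilon> \<mu> f f \<in> \<real>" "Re (maxwell_inner \<epsilon> \<mu> f f) > 0"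
proof -
  show "maxwell_inner \<epsilon> \<mu> f f \<in> \<real>"
    by (transfer fixing: \<epsilon> \<mu>) (simp add: cdot_Dhat[OF assms(1,2)] del: of_real_sum)
  show "Re (maxwell_inner \<epsilon> \<mu> f f) > 0"
    using assms(3)
  proof (transfer fixing: \<epsilon> \<mu>)
    fix u :: "torus \<Rightarrow> c6"
    let ?Q = "\<lambda>x. \<Sum>i\<in>UNIV. (cmod (u x $ i))\<^sup>2 / dvec \<epsilon> \<mu> $ i"
    assume u: "L2_rel u u" and ne: "\<not> L2_rel u (\<lambda>x. 0)"
    have int: "integrable torus_measure ?Q"
      using u by (intro weighted_integrable assms) (auto simp: L2_rel_def)
    have nn: "?Q x \<ge> 0" for x
      by (intro sum_nonneg) (simp add: dvec_pos[OF assms(1,2)] less_imp_le)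
    have z: "u x = 0" if "?Q x = 0" for x
      using norm_le_weighted[OF assms(1,2), of "u x"] that by simp
    have "(LINT x|torus_measure. ?Q x) \<noteq> 0"
    proof
      assume "(LINT x|torus_measure. ?Q x) = 0"
      then have "AE x in torus_measure. ?Q x = 0"
        using integral_nonneg_eq_0_iff_AE[OF int] nn by simp
      then have "AE x in torus_measure. u x = 0"
        by eventually_elim (rule z)
      with u ne show False
        by (simp add: L2_rel_def square_integrable_zero)
    qed
    moreover have "(LINT x|torus_measure. ?Q x) \<ge> 0"
      by (rule integral_nonneg_AE) (simp add: nn)
    ultimately show "0 < Re (LINT x|torus_measure.
        cdot (complex_matrix (matrix_inv (Dhat \<epsilon> \<mu>)) *v u x) (u x))"
      by (simp add: cdot_Dhat[OF assms(1,2)] del: of_real_sum)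
  qed
qed

lemma maxwell_op_bounded:
  assumes "\<And>j. \<epsilon> $ j > 0" "\<And>j. \<mu> $ j > 0"
  obtains C where "\<And>f. Re (maxwell_inner \<epsilon> \<mu> (maxwell_op \<epsilon> \<mu> f) (maxwell_op \<epsilon> \<mu> f))
    \<le> C * Re (maxwell_inner \<epsilon> \<mu> f f)"
proof -
  let ?Q = "\<lambda>a :: c6. \<Sum>i\<in>UNIV. (cmod (a $ i))\<^sup>2 / dvec \<epsilon> \<mu> $ i"
  let ?H = "\<lambda>x. complex_matrix (maxwell_matrix \<epsilon> \<mu> x)"
  define K where "K = (\<Sum>i\<in>UNIV. 1 / dvec \<epsilon> \<mu> $ i)"
  define L where "L = (\<Sum>i\<in>UNIV. dvec \<epsilon> \<mu> $ i)"
  have K: "K \<ge> 0"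
    unfolding K_def by (intro sum_nonneg) (simp add: dvec_pos[OF assms] less_imp_le)
  obtain C where C: "\<And>x a. norm (?H x *v a) \<le> C * norm a"
    using maxwell_matrix_bounded[of \<epsilon> \<mu>] by blast
  have *: "?Q (?H x *v a) \<le> K * C\<^sup>2 * L * ?Q a" for x a
  proof -
    have "?Q (?H x *v a) \<le> K * (norm (?H x *v a))\<^sup>2"
      unfolding K_def by (rule weighted_le_norm[OF assms])
    also have "\<dots> \<le> K * (C\<^sup>2 * (norm a)\<^sup>2)"
      using power_mono[OF C norm_ge_zero, of x a 2] K by (intro mult_left_mono) (simp_all add: power_mult_distrib)
    also have "\<dots> \<le> K * (C\<^sup>2 * (L * ?Q a))"
      unfolding L_def using K by (intro mult_left_mono norm_le_weighted[OF assms]) simp_all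
    finally show ?thesis
      by (simp only: mult.assoc)
  qed
  have "Re (maxwell_inner \<epsilon> \<mu> (maxwell_op \<epsilon> \<mu> f) (maxwell_op \<epsilon> \<mu> f))
      \<le> (K * C\<^sup>2 * L) * Re (maxwell_inner \<epsilon> \<mu> f f)" for f
  proof (transfer fixing: \<epsilon> \<mu> K C L)
    fix u assume "L2_rel u u"
    then have u: "square_integrable u"
      by (simp add: L2_rel_def)
    have "(LINT x|torus_measure. ?Q (?H x *v u x)) \<le> (LINT x|torus_measure. K * C\<^sup>2 * L * ?Q (u x))"
      by (rule integral_mono[OF weighted_integrable[OF assms square_integrable_maxwell[OF u]]
            integrable_mult_right[OF weighted_integrable[OF assms u]] *])
    also have "\<dots> = K * C\<^sup>2 * L * (LINT x|torus_measure. ?Q (u x))"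
      by (rule integral_mult_right_zero)
    finally show "Re (LINT x|torus_measure.
          cdot (complex_matrix (matrix_inv (Dhat \<epsilon> \<mu>)) *v (?H x *v u x)) (?H x *v u x))
        \<le> K * C\<^sup>2 * L * Re (LINT x|torus_measure.
          cdot (complex_matrix (matrix_inv (Dhat \<epsilon> \<mu>)) *v u x) (u x))"
      by (simp add: cdot_Dhat[OF assms] del: of_real_sum)
  qed
  then show ?thesis
    by (rule that)
qed

end

theory Submission
  imports Defs
begin

text \<open>
  A multiplication operator has the eigenvalue \<open>\<lambda>\<close> exactly when \<open>\<lambda>\<close> is an eigenvalue of its
  symbol \<open>H(x)\<close> for \<open>x\<close> in a set of positive measure.

  The value \<open>\<lambda> = 0\<close> is attained at every point: since \<open>y \<times> y = 0\<close>, the vector \<open>(y, 0)\<close> is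
  annihilated by \<open>h(y)\<close>. The function \<open>x \<mapsto> (sin x, 0)\<close> is bounded and nonzero almost
  everywhere, so it is an eigenfunction.

  For \<open>\<lambda> \<noteq> 0\<close>, an eigenvector \<open>(a, b)\<close> of \<open>h(y)\<close> has \<open>b \<noteq> 0\<close>, and eliminating \<open>a\<close> turns the
  \<open>6 \<times> 6\<close> problem into the \<open>3 \<times> 3\<close> problem \<open>- \<mu> M(y) \<epsilon> M(y) b = \<lambda>\<^sup>2 b\<close>. Its characteristic
  polynomial, divided by the factor \<open>- \<lambda>\<^sup>2\<close> coming from longitudinal fields, is Fresnel's
  polynomial. With \<open>\<lambda>\<close>, \<open>y\<^sub>2\<close> and \<open>y\<^sub>3\<close> held fixed, this is a quartic in \<open>y\<^sub>1\<close> with leading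
  coefficient \<open>\<epsilon>\<^sub>2 \<epsilon>\<^sub>3 \<mu>\<^sub>2 \<mu>\<^sub>3 > 0\<close>, so it has at most four zeros, whatever \<open>y\<^sub>2\<close> and \<open>y\<^sub>3\<close> are.
  Since \<open>sin\<close> takes each value at countably many points only, the set of \<open>x\<close> for which \<open>\<lambda>\<close> is an
  eigenvalue of \<open>H(x)\<close> meets every line parallel to the first axis in a countable set. By Fubini
  it is a null set (\<open>AE_torus_symbol_nonzero\<close>), so no nonzero \<open>L\<^sup>2\<close> function can be an
  eigenfunction.
\<close>

section \<open>Null sets on the torus\<close>

text \<open>
  Fubini is applied to the pairs \<open>(y, t)\<close> with \<open>y + t v \<in> S\<close>, rather than to a splitting of the
  space into the direction \<open>v\<close> and a complement. For fixed \<open>y\<close> the values of \<open>t\<close> form a null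
  set; hence for some \<open>t\<close> the translate of \<open>S\<close> by \<open>- t v\<close> is null, and Lebesgue measure is
  invariant under translations.
\<close>

lemma null_if_countable_sections:
  fixes S :: "'a::euclidean_space set"
  assumes S [measurable]: "S \<in> sets borel" and "\<And>y. countable {t. y + t *\<^sub>R v \<in> S}"
  shows "emeasure lborel S = 0"
proof -
  have "AE y in lborel. AE t in lborel. y + t *\<^sub>R v \<notin> S"
    using countable_imp_null_set_lborel[OF assms(2)] by (auto simp: AE_iff_null_sets)
  then have "AE t in lborel. AE y in lborel. y + t *\<^sub>R v \<notin> S"
    by (subst lborel_pair.AE_commute) measurable
  then obtain t where t: "AE y in lborel. y + t *\<^sub>R v \<notin> S"
    using eventually_happens[of _ "ae_filter (lborel :: real measure)"]
    by (auto simp: trivial_limit_def[symmetric] ae_filter_eq_bot_iff)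
  have "AE y in distr lborel borel ((+) (t *\<^sub>R v)). y \<notin> S"
    using t by (subst AE_distr_iff) (auto simp: add.commute)
  then have "AE y in lborel. y \<notin> S"
    unfolding lborel_distr_plus .
  then show ?thesis
    using AE_iff_null_sets[of S lborel] by (simp add: null_setsD1)
qed

lemma countable_sin_vimage_singleton: "countable {t :: real. sin (a + t) = s}"
proof (cases "\<exists>t0. sin (a + t0) = s")
  case True
  then obtain t0 where t0: "sin (a + t0) = s" by blast
  have "{t. sin (a + t) = s} \<subseteq>
    range (\<lambda>n::int. t0 + 2 * of_int n * pi) \<union> range (\<lambda>n::int. - 2 * a - t0 + (2 * of_int n + 1) * pi)"
    unfolding t0[symmetric] sin_eq by (auto elim!: Ints_cases simp: algebra_simps image_def)
  then show ?thesis
    by (rule countable_subset) simp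
qed simp

text \<open>
  The finiteness hypothesis must hold for every choice of the last two coordinates: it then makes
  the zero set in the variable \<open>x\<close> countable on each line parallel to the first axis, because the
  preimage of a finite set under \<open>sin\<close> is countable.
\<close>

lemma AE_torus_symbol_nonzero:
  fixes q :: "real ^ 3 \<Rightarrow> complex"
  assumes "continuous_on UNIV q" and "\<And>y. finite {s. q (\<chi> j. if j = 1 then s else y $ j) = 0}"
  shows "AE x in torus_measure. q (\<chi> j. circle_sin (x $ j)) \<noteq> 0"
proof -
  let ?s = "\<lambda>y :: real ^ 3. \<chi> j. sin (y $ j)"
  define Z where "Z = {x. q (\<chi> j. circle_sin (x $ j)) = 0}"
  have vimage: "torus_proj -` Z = {y. q (?s y) = 0}"
    by (simp add: Z_def)
  have "closed {y. q (?s y) = 0}"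
    by (intro closed_Collect_eq continuous_on_compose2[OF assms(1)] continuous_intros) auto
  then have borel: "{y. q (?s y) = 0} \<in> sets borel"
    by (rule borel_closed)
  have "countable {t. y + t *\<^sub>R axis 1 1 \<in> {y. q (?s y) = 0}}" for y
  proof -
    let ?R = "{s. q (\<chi> j. if j = 1 then s else ?s y $ j) = 0}"
    have "?s (y + t *\<^sub>R axis 1 1) = (\<chi> j. if j = 1 then sin (y $ 1 + t) else ?s y $ j)" for t
      by (auto simp: vec_eq_iff axis_def)
    then have "{t. y + t *\<^sub>R axis 1 1 \<in> {y. q (?s y) = 0}} = (\<Union>s\<in>?R. {t. sin (y $ 1 + t) = s})"
      by auto
    with assms(2)[of "?s y"] show ?thesis
      by (simp only:) (intro countable_UN countable_finite countable_sin_vimage_singleton)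
  qed
  then have "emeasure lborel {y. q (?s y) = 0} = 0"
    by (rule null_if_countable_sections[OF borel])
  then have null: "{y. q (?s y) = 0} \<in> null_sets lborel"
    using borel by auto
  have Z: "Z \<in> sets torus_measure"
    using borel vimage by (simp add: sets_torus_measure)
  have "emeasure torus_measure Z = 0"
    unfolding emeasure_torus_measure[OF Z] vimage
    by (rule null_setsD1, rule null_set_Int2[OF null]) measurable
  with Z have "Z \<in> null_sets torus_measure"
    by auto
  then show ?thesis
    by (rule AE_I') (auto simp: Z_def)
qed

lemma finite_torus_measure: "finite_measure torus_measure"
proof (rule finite_measureI)
  have "bounded {y :: real ^ 3. \<forall>j. 0 \<le> y $ j \<and> y $ j < 2 * pi}"
    by (rule bounded_subset[OF bounded_cbox[of 0 "\<chi> j. 2 * pi"]]) (auto simp: mem_box_cart less_imp_le)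
  then show "emeasure torus_measure (space torus_measure) \<noteq> \<infinity>"
    using emeasure_bounded_finite
    by (subst emeasure_torus_measure) (auto simp: sets_torus_measure less_top[symmetric])
qed

lemma torus_measure_nontrivial: "\<not> (AE x in torus_measure. False)"
proof
  let ?Q = "{y :: real ^ 3. \<forall>j. 0 \<le> y $ j \<and> y $ j < 2 * pi}"
  let ?B = "box 0 (\<chi> j. 2 * pi) :: (real ^ 3) set"
  assume "AE x in torus_measure. False"
  then have "emeasure torus_measure UNIV = 0"
    by (subst (asm) AE_iff_measurable[of UNIV]) (auto simp: sets_torus_measure)
  then have "emeasure lborel ?Q = 0"
    by (subst (asm) emeasure_torus_measure) (simp_all add: sets_torus_measure)
  moreover have "?Q \<in> sets lborel"
    by measurable
  ultimately have "?Q \<in> null_sets lborel"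
    by (rule null_setsI)
  moreover have "?B \<in> sets lborel"
    by (simp add: open_box borel_open)
  moreover have "?B \<subseteq> ?Q"
    by (auto simp: mem_box_cart less_imp_le)
  ultimately have "?B \<in> null_sets lborel"
    by (rule null_sets_subset)
  then have "negligible ?B"
    unfolding negligible_iff_null_sets by (rule null_sets_completionI)
  moreover have "(\<chi> j. pi) \<in> ?B"
    by (simp add: mem_box_cart)
  ultimately show False
    using open_not_negligible[OF open_box] by blast
qed

section \<open>Nonzero eigenvalues and Fresnel's polynomial\<close>

text \<open>
  The left-hand side of Fresnel's equation for the wave normals of a biaxial crystal, with \<open>c\<close>
  the squared frequency and \<open>y\<close> the wave vector. The constant term is
  \<open>\<epsilon>\<^sub>1 \<epsilon>\<^sub>2 \<epsilon>\<^sub>3 \<mu>\<^sub>1 \<mu>\<^sub>2 \<mu>\<^sub>3 (\<Sum>\<^sub>j y\<^sub>j\<^sup>2 / \<epsilon>\<^sub>j) (\<Sum>\<^sub>j y\<^sub>j\<^sup>2 / \<mu>\<^sub>j)\<close> with denominators cleared.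
\<close>

definition fresnel :: "real ^ 3 \<Rightarrow> real ^ 3 \<Rightarrow> complex \<Rightarrow> real ^ 3 \<Rightarrow> complex" where
  "fresnel \<epsilon> \<mu> c y = c\<^sup>2
    - of_real ((\<epsilon> $ 2 * \<mu> $ 3 + \<epsilon> $ 3 * \<mu> $ 2) * (y $ 1)\<^sup>2
             + (\<epsilon> $ 3 * \<mu> $ 1 + \<epsilon> $ 1 * \<mu> $ 3) * (y $ 2)\<^sup>2
             + (\<epsilon> $ 1 * \<mu> $ 2 + \<epsilon> $ 2 * \<mu> $ 1) * (y $ 3)\<^sup>2) * c
    + of_real ((\<epsilon> $ 2 * \<epsilon> $ 3 * (y $ 1)\<^sup>2 + \<epsilon> $ 3 * \<epsilon> $ 1 * (y $ 2)\<^sup>2 + \<epsilon> $ 1 * \<epsilon> $ 2 * (y $ 3)\<^sup>2)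
             * (\<mu> $ 2 * \<mu> $ 3 * (y $ 1)\<^sup>2 + \<mu> $ 3 * \<mu> $ 1 * (y $ 2)\<^sup>2 + \<mu> $ 1 * \<mu> $ 2 * (y $ 3)\<^sup>2))"

text \<open>
  The factor \<open>c\<close> splits off because the second-order operator \<open>- \<mu> M(y) \<epsilon> M(y)\<close> annihilates \<open>y\<close>.
\<close>

lemma det_second_order_maxwell:
  "det (complex_matrix ((- (diag \<mu> ** Mcross y)) ** (diag \<epsilon> ** Mcross y)) - mat c)
    = - c * fresnel \<epsilon> \<mu> c y"
  by (simp add: det_3 complex_matrix_def matrix_matrix_mult_def[of "- _"] diag_mult_nth sum_3
      mat_def Mcross_def fresnel_def) algebra

text \<open>
  The only term of degree four in \<open>s\<close> comes from the product of the two quadratic forms in the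
  constant term; its coefficient depends neither on \<open>c\<close> nor on the other two coordinates, so the
  polynomial never degenerates.
\<close>

lemma finite_fresnel_zeros:
  assumes "\<And>j. \<epsilon> $ j > 0" and "\<And>j. \<mu> $ j > 0"
  shows "finite {s. fresnel \<epsilon> \<mu> c (\<chi> j. if j = 1 then s else y $ j) = 0}"
proof -
  define a1 where "a1 = \<epsilon> $ 3 * \<epsilon> $ 1 * (y $ 2)\<^sup>2 + \<epsilon> $ 1 * \<epsilon> $ 2 * (y $ 3)\<^sup>2"
  define a2 where "a2 = \<mu> $ 3 * \<mu> $ 1 * (y $ 2)\<^sup>2 + \<mu> $ 1 * \<mu> $ 2 * (y $ 3)\<^sup>2"
  define a3 where "a3 = (\<epsilon> $ 3 * \<mu> $ 1 + \<epsilon> $ 1 * \<mu> $ 3) * (y $ 2)\<^sup>2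
             + (\<epsilon> $ 1 * \<mu> $ 2 + \<epsilon> $ 2 * \<mu> $ 1) * (y $ 3)\<^sup>2"
  define p :: "complex poly" where "p = [: c\<^sup>2 - of_real a3 * c + of_real (a1 * a2), 0,
    of_real (\<epsilon> $ 2 * \<epsilon> $ 3 * a2 + \<mu> $ 2 * \<mu> $ 3 * a1)
      - of_real (\<epsilon> $ 2 * \<mu> $ 3 + \<epsilon> $ 3 * \<mu> $ 2) * c,
    0, of_real (\<epsilon> $ 2 * \<epsilon> $ 3 * (\<mu> $ 2 * \<mu> $ 3)) :]"
  have "\<epsilon> $ 2 * \<epsilon> $ 3 * (\<mu> $ 2 * \<mu> $ 3) > 0"
    using assms by simp
  then have "p \<noteq> 0"
    unfolding p_def by (auto simp: less_le)
  then have "finite {z. poly p z = 0}"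
    by (rule poly_roots_finite)
  then have "finite {s. poly p (of_real s) = 0}"
    using finite_vimageI[of "{z. poly p z = 0}" of_real] by (simp add: inj_on_def vimage_def)
  moreover have "fresnel \<epsilon> \<mu> c (\<chi> j. if j = 1 then s else y $ j) = poly p (of_real s)" for s
    by (simp add: fresnel_def p_def a1_def a2_def a3_def power2_eq_square algebra_simps)
  ultimately show ?thesis
    by simp
qed

lemma antidiagonal_block_mult:
  fixes B :: "real ^ 'm::finite ^ 'n::finite" and u :: "complex ^ ('n + 'm)"
  shows "(complex_matrix (block_matrix 0 B C 0) *v u) $ Inl k
      = (complex_matrix B *v (\<chi> l. u $ Inr l)) $ k"
    and "(complex_matrix (block_matrix 0 B C 0) *v u) $ Inr l
      = (complex_matrix C *v (\<chi> k. u $ Inl k)) $ l"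
  by (simp_all add: matrix_vector_mult_def complex_matrix_def block_matrix_def
      UNIV_Plus_UNIV[symmetric] sum.Plus del: UNIV_Plus_UNIV)

lemma complex_matrix_mult:
  "complex_matrix A *v (complex_matrix B *v u) = complex_matrix (A ** B) *v u"
proof -
  have "complex_matrix A ** complex_matrix B = complex_matrix (A ** B)"
    by (simp add: complex_matrix_def matrix_matrix_mult_def vec_eq_iff)
  then show ?thesis
    by (simp add: matrix_vector_mul_assoc)
qed

text \<open>
  With \<open>B = \<epsilon> M(y)\<close> and \<open>C = - \<mu> M(y)\<close>, the block rows read \<open>B b = c a\<close> and \<open>C a = c b\<close>.
  Hence \<open>C B b = c\<^sup>2 b\<close>, and \<open>b = 0\<close> would force \<open>a = 0\<close>.
\<close>

lemma fresnel_eq_0_if_eigenvector: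
  assumes "complex_matrix (maxwell_symbol \<epsilon> \<mu> y) *v u = c *s u" and "c \<noteq> 0" and "u \<noteq> 0"
  shows "fresnel \<epsilon> \<mu> (c\<^sup>2) y = 0"
proof -
  define B where "B = diag \<epsilon> ** Mcross y"
  define C where "C = - (diag \<mu> ** Mcross y)"
  define a where "a = (\<chi> k. u $ Inl k)"
  define b where "b = (\<chi> l. u $ Inr l)"
  note H = assms(1)[unfolded maxwell_symbol_def, folded B_def C_def]
  have ca: "complex_matrix B *v b = c *s a"
    using antidiagonal_block_mult(1)[of B C u] unfolding H by (simp add: vec_eq_iff a_def b_def)
  have cb: "complex_matrix C *v a = c *s b"
    using antidiagonal_block_mult(2)[of B C u] unfolding H by (simp add: vec_eq_iff a_def b_def)
  have "b \<noteq> 0"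
  proof
    assume "b = 0"
    with ca assms(2) have "a = 0" by simp
    with \<open>b = 0\<close> have "u $ i = 0" for i
      by (cases i) (auto simp: a_def b_def vec_eq_iff)
    with assms(3) show False
      by (simp add: vec_eq_iff)
  qed
  have "complex_matrix (C ** B) *v b = complex_matrix C *v (c *s a)"
    by (simp add: complex_matrix_mult[symmetric] ca)
  also have "\<dots> = c\<^sup>2 *s b"
    by (simp add: vector_scalar_commute cb power2_eq_square)
  also have "\<dots> = mat (c\<^sup>2) *v b"
    by (simp add: vec_eq_iff matrix_vector_mult_def mat_def if_distrib[of "\<lambda>x. x * _"] cong: if_cong)
  finally have "(complex_matrix (C ** B) - mat (c\<^sup>2)) *v b = 0"
    by (simp add: matrix_vector_mult_diff_rdistrib)
  with \<open>b \<noteq> 0\<close> have "det (complex_matrix (C ** B) - mat (c\<^sup>2)) = 0"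
    by (metis invertible_det_nz invertible_left_inverse matrix_left_invertible_ker)
  then show ?thesis
    using assms(2) unfolding B_def C_def det_second_order_maxwell by simp
qed

lemma maxwell_op_no_nonzero_eigenvalue:
  assumes "\<And>j. \<epsilon> $ j > 0" and "\<And>j. \<mu> $ j > 0"
    and "maxwell_op \<epsilon> \<mu> f = c *\<^sub>L f" and "c \<noteq> 0"
  shows "f = 0"
  using assms(3)
proof (transfer fixing: \<epsilon> \<mu> c)
  fix u
  assume u: "L2_rel u u"
    and "L2_rel (\<lambda>x. complex_matrix (maxwell_matrix \<epsilon> \<mu> x) *v u x) (\<lambda>x. c *s u x)"
  then have "AE x in torus_measure. complex_matrix (maxwell_matrix \<epsilon> \<mu> x) *v u x = c *s u x"
    by (simp add: L2_rel_def)
  moreover have "continuous_on UNIV (fresnel \<epsilon> \<mu> (c\<^sup>2))"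
    unfolding fresnel_def by (intro continuous_intros)
  from AE_torus_symbol_nonzero[OF this finite_fresnel_zeros[OF assms(1,2)]]
  have "AE x in torus_measure. fresnel \<epsilon> \<mu> (c\<^sup>2) (\<chi> j. circle_sin (x $ j)) \<noteq> 0" .
  ultimately have "AE x in torus_measure. u x = 0"
    by eventually_elim
      (metis assms(4) fresnel_eq_0_if_eigenvector maxwell_matrix_def)
  with u show "L2_rel u (\<lambda>x. 0)"
    by (simp add: L2_rel_def square_integrable_zero)
qed

section \<open>The kernel\<close>

lemma Mcross_self: "Mcross y *v y = 0"
  by (simp add: vec_eq_iff forall_3 Mcross_def matrix_vector_mult_def sum_3)

text \<open>
  The longitudinal fields: \<open>M(y) y = y \<times> y = 0\<close>, so a first component parallel to \<open>y\<close> is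
  annihilated.
\<close>

lemma maxwell_symbol_kernel:
  "complex_matrix (maxwell_symbol \<epsilon> \<mu> y) *v (\<chi> i. case i of Inl k \<Rightarrow> of_real (y $ k) | Inr k \<Rightarrow> 0) = 0"
    (is "?H *v ?u = 0")
proof -
  have c: "complex_matrix A *v (\<chi> k. of_real (y $ k)) = (\<chi> k. of_real ((A *v y) $ k))"
    for A :: "real ^ 3 ^ 3"
    by (simp add: complex_matrix_def matrix_vector_mult_def)
  have neg: "(- A) *v y = - (A *v y)" for A :: "real ^ 3 ^ 3"
    by (simp add: vec_eq_iff matrix_vector_mult_def sum_negf)
  have "(- (diag \<mu> ** Mcross y)) *v y = 0"
    by (simp add: neg Mcross_self flip: matrix_vector_mul_assoc)
  then have "(?H *v ?u) $ i = 0" for i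
    by (cases i) (simp_all add: maxwell_symbol_def antidiagonal_block_mult c,
       simp_all add: matrix_vector_mult_def)
  then show ?thesis
    by (simp add: vec_eq_iff)
qed

text \<open>
  The field \<open>(sin x, 0)\<close> lies pointwise in the kernel of the symbol. It is not zero in \<open>L\<^sup>2\<close>
  because \<open>sin x\<^sub>1\<close> vanishes only on a null set.
\<close>

lemma maxwell_op_kernel_nontrivial: "\<exists>f. f \<noteq> 0 \<and> maxwell_op \<epsilon> \<mu> f = 0"
proof -
  define u :: "torus \<Rightarrow> c6" where
    "u x = (\<chi> i. case i of Inl k \<Rightarrow> of_real (circle_sin (x $ k)) | Inr k \<Rightarrow> 0)" for x
  have [measurable]: "u \<in> borel_measurable torus_measure"
  proof (rule borel_measurable_vec)
    show "(\<lambda>x. u x $ i) \<in> borel_measurable torus_measure" for i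
      by (cases i) (simp_all add: u_def)
  qed
  \<comment> \<open>six components, each of modulus at most one\<close>
  have "norm (u x) \<le> 6" for x
  proof -
    have s: "\<bar>circle_sin a\<bar> \<le> 1" for a
      by transfer simp
    have "norm (u x) \<le> (\<Sum>i\<in>UNIV. norm (u x $ i))"
      unfolding norm_vec_def by (rule L2_set_le_sum) simp
    also have "\<dots> \<le> (\<Sum>(i::3 + 3)\<in>UNIV. 1)"
      using s by (intro sum_mono) (auto simp: u_def split: sum.split)
    finally show ?thesis
      by simp
  qed
  then have "norm ((norm (u x))\<^sup>2) \<le> 6\<^sup>2" for x
    using power_mono[of "norm (u x)" 6 2] by simp
  then have "integrable torus_measure (\<lambda>x. (norm (u x))\<^sup>2)"
    by (intro finite_measure.integrable_const_bound[OF finite_torus_measure]) auto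
  then have sq: "square_integrable u"
    by (simp add: square_integrable_def)
  have "\<not> (AE x in torus_measure. u x = 0)"
  proof
    assume "AE x in torus_measure. u x = 0"
    moreover have "AE x in torus_measure.
        complex_of_real ((\<chi> j. circle_sin (x $ j)) $ 1) \<noteq> 0"
      by (rule AE_torus_symbol_nonzero) (simp_all add: continuous_on_of_real continuous_on_component)
    ultimately have "AE x in torus_measure. False"
    proof eventually_elim
      case (elim x)
      have "u x $ Inl 1 = complex_of_real (circle_sin (x $ 1))"
        by (simp add: u_def)
      with elim show False
        by simp
    qed
    then show False
      using torus_measure_nontrivial by simp
  qed
  then have ne: "\<not> L2_rel u (\<lambda>x. 0)"
    by (simp add: L2_rel_def)
  have "complex_matrix (maxwell_matrix \<epsilon> \<mu> x) *v u x = 0" for x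
    using maxwell_symbol_kernel[of \<epsilon> \<mu> "\<chi> j. circle_sin (x $ j)"]
    by (simp only: maxwell_matrix_def u_def vec_lambda_beta)
  then have "maxwell_op \<epsilon> \<mu> (abs_L2 u) = 0"
    using sq by (simp add: maxwell_op.abs_eq L2_rel_def zero_L2_def)
  moreover have "abs_L2 u \<noteq> 0"
    using Quotient3_rel[OF Quotient3_L2, of u "\<lambda>x. 0"] sq ne
    by (auto simp: zero_L2_def L2_rel_def square_integrable_zero)
  ultimately show ?thesis
    by blast
qed

theorem corollary4:
  fixes \<epsilon> \<mu> :: "real ^ 3"
  assumes "\<And>j. \<epsilon> $ j > 0" and "\<And>j. \<mu> $ j > 0"
  shows "point_spectrum (maxwell_op \<epsilon> \<mu>) = {0}"
proof
  show "point_spectrum (maxwell_op \<epsilon> \<mu>) \<subseteq> {0}"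
    using maxwell_op_no_nonzero_eigenvalue[OF assms] by (auto simp: point_spectrum_def)
  show "{0} \<subseteq> point_spectrum (maxwell_op \<epsilon> \<mu>)"
    using maxwell_op_kernel_nontrivial by (auto simp: point_spectrum_def)
qed

end
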